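(* Let $\bm X\sim N(\bm\mu_{\bm X},\Sigma_{\bm X})$ in $\mathbb R^n$ and $\bm Y\sim N(\bm\mu_{\bm Y},\Sigma_{\bm Y})$ in $\mathbb R^m$ be independent, with unknown means and known covariance matrices, and let $(\bm X^{\rm obs},\bm Y^{\rm obs})$ be observed data, with sign vector $\bm s_{\rm obs}=\mathcal S(\bm X^{\rm obs},\bm Y^{\rm obs})$ and selected set of basic variables $\mathcal M_{\rm obs}=\mathcal M(\bm X^{\rm obs},\bm Y^{\rm obs})$ of the linear program defining the Wasserstein distance. Assume that the event $E=\{\mathcal S(\bm X,\bm Y)=\bm s_{\rm obs},\ \mathcal M(\bm X,\bm Y)=\mathcal M_{\rm obs}\}$ has positive probability. Let $\bm\eta$ be the test-statistic direction determined by $(\bm s_{\rm obs},\mathcal M_{\rm obs})$, assume $\sigma^2=\bm\eta^\top\tilde\Sigma\bm\eta>0$, and let $W^\ast=\bm\eta^\top\binom{\bm\mu_{\bm X}}{\bm\mu_{\bm Y}}$. For $\alpha\in[0,1]$ let $C_{\rm sel}$ be the selective confidence interval, regarded as a function of the data: on $E$, $$C_{\rm sel}=\left\{w\in\mathbb R:\ \frac{\alpha}{2}\le F^{\mathcal Z}_{w,\sigma^2}\left(\bm\eta^\top\binom{\bm X}{\bm Y}\right)\le 1-\frac{\alpha}{2}\right\},$$ where $F^{\mathcal Z}_{w,\sigma^2}$ is the c.d.f. of the normal distribution $N(w,\sigma^2)$ truncated to the set $\mathcal Z=\mathcal Z(\bm X,\bm Y)$ defined in the context. Then for every $\alpha\in[0,1]$,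 $$\mathbb P\Big(W^\ast\in C_{\rm sel}\ \Big|\ \mathcal S(\bm X,\bm Y)=\mathcal S(\bm X^{\rm obs},\bm Y^{\rm obs}),\ \mathcal M(\bm X,\bm Y)=\mathcal M_{\rm obs}\Big)=1-\alpha .$$
   Context: All vectors are columns; $\binom{\bm X}{\bm Y}\in\mathbb R^{n+m}$ is the stacked vector, and $\tilde\Sigma=\begin{pmatrix}\Sigma_{\bm X}&0\\0&\Sigma_{\bm Y}\end{pmatrix}$ is its covariance. Matrix $\Omega\in\mathbb R^{nm\times(n+m)}$: its rows are indexed by pairs $(i,j)$, $i\in[n]$, $j\in[m]$, in row-major order (row number $(i-1)m+j$), and row $(i,j)$ has $+1$ in column $i$, $-1$ in column $n+j$, and $0$ elsewhere. Sign vector: $\mathcal S(\bm X,\bm Y)=\mathrm{sign}\big(\Omega\binom{\bm X}{\bm Y}\big)\in\mathbb R^{nm}$, entrywise. For a sign vector $\bm s$, $\Theta=\bm s\circ\Omega$ is the matrix $\Omega$ with each row multiplied by the corresponding entry of $\bm s$. With $\bm s=\mathcal S(\bm X,\bm Y)$, the vectorized cost matrix is $\bm c(\bm X,\bm Y)=\Theta\binom{\bm X}{\bm Y}$, whose $(i,j)$ entry is $|x_i-y_j|$. Linear program (Wasserstein distance between the empirical measures of the entries of $\bm X$ and of $\bm Y$, with $\ell_1$ cost): minimize $\bm t^\top\bm c(\bm X,\bm Y)$ over $\bm t\in\mathbb R^{nm}$ subject to $S\bm t=\bm h$, $\bm t\ge\bm 0$. Here $S$ is obtained from the $(n+m)\times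 nm$ matrix with the $n$ constraints $\sum_j t_{ij}$ ($i\in[n]$) followed by the $m$ constraints $\sum_i t_{ij}$ ($j\in[m]$), and $\bm h$ from the vector with entries $1/n$ ($n$ times) followed by $1/m$ ($m$ times), by deleting the last (redundant) row of $S$ and the last entry of $\bm h$. The LP is assumed non-degenerate. $\mathcal M(\bm X,\bm Y)\subset[nm]$, of size $n+m-1$, is the set of indices of basic variables of the optimal basis returned when the LP is solved on the data $(\bm X,\bm Y)$; it is a fixed (deterministic, measurable) function of the data. Given $\mathcal M_{\rm obs}$, put $\hat{\bm t}_{\mathcal M_{\rm obs}}=S_{:,\mathcal M_{\rm obs}}^{-1}\bm h$, where $S_{:,\mathcal M_{\rm obs}}$ consists of the columns of $S$ in $\mathcal M_{\rm obs}$. The test-statistic direction is $\bm\eta=\Theta_{\mathcal M_{\rm obs},:}^\top\hat{\bm t}_{\mathcal M_{\rm obs}}\in\mathbb R^{n+m}$, with $\Theta=\bm s_{\rm obs}\circ\Omega$ and $\Theta_{\mathcal M_{\rm obs},:}$ its rows in $\mathcal M_{\rm obs}$. On the event $E$ the Wasserstein distance equals $\bm\eta^\top\binom{\bm X}{\bm Y}$. Let $\bm b=\tilde\Sigma\bm\eta(\bm\eta^\top\tilde\Sigma\bm\eta)^{-1}$ and $\bm q(\bm X,\bm Y)=(I_{n+m}-\bm b\bm\eta^\top)\binom{\bm X}{\bm Y}$. The truncation region is $$\mathcal Z(\bm X,\bm Y)=\{z\in\mathbb R:\ \mathcal S(\bm q(\bm X,\bm Y)+\bm bz)=\bm s_{\rm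 obs},\ \mathcal M(\bm q(\bm X,\bm Y)+\bm bz)=\mathcal M_{\rm obs}\},$$ where $\mathcal S(\cdot)$ and $\mathcal M(\cdot)$ applied to a vector in $\mathbb R^{n+m}$ mean the same functions applied to its two blocks. *)

theory Defs
  imports "HOL-Probability.Probability"
begin

text \<open>
  The index sets [n] and [m] are the finite types 'n and 'm, positions in a stacked vector are
  elements of 'n + 'm, and a position (i,j) of a vectorised n-by-m matrix is the pair itself.
\<close>

section \<open>Multivariate normal distributions\<close>

definition std_normal_vec :: "(real^'n) measure" where
  "std_normal_vec = density lborel (\<lambda>x. ennreal (\<Prod>i\<in>UNIV. std_normal_density (x $ i)))"

text \<open>
  N(mu, Sigma), possibly degenerate: the law of mu + A g with g standard normal and
  A A^T = Sigma. The law does not depend on the choice of A.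
\<close>

definition has_normal_law ::
    "'a measure \<Rightarrow> ('a \<Rightarrow> real^'n) \<Rightarrow> real^'n \<Rightarrow> real^'n^'n \<Rightarrow> bool" where
  "has_normal_law P X \<mu> \<Sigma> \<longleftrightarrow>
     X \<in> borel_measurable P \<and>
     (\<exists>A :: real^'n^'n. A ** transpose A = \<Sigma> \<and>
        distr P borel X = distr std_normal_vec borel (\<lambda>g. \<mu> + A *v g))"

section \<open>Stacked vectors, signs and cost vector\<close>

definition stack :: "real^'n \<Rightarrow> real^'m \<Rightarrow> real^('n + 'm)" where
  "stack x y = (\<chi> k. case k of Inl i \<Rightarrow> x $ i | Inr j \<Rightarrow> y $ j)"

definition block1 :: "real^('n::finite + 'm::finite) \<Rightarrow> real^'n" where
  "block1 v = (\<chi> i. v $ Inl i)"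

definition block2 :: "real^('n::finite + 'm::finite) \<Rightarrow> real^'m" where
  "block2 v = (\<chi> j. v $ Inr j)"

definition block_diag :: "real^'n^'n \<Rightarrow> real^'m^'m \<Rightarrow> real^('n + 'm)^('n + 'm)" where
  "block_diag A B = (\<chi> k l.
     case (k, l) of
       (Inl i, Inl i') \<Rightarrow> A $ i $ i'
     | (Inr j, Inr j') \<Rightarrow> B $ j $ j'
     | _ \<Rightarrow> 0)"

definition Omega :: "real^('n::finite + 'm::finite)^('n \<times> 'm)" where
  "Omega = (\<chi> p c.
     case c of
       Inl i \<Rightarrow> if i = fst p then 1 else 0
     | Inr j \<Rightarrow> if j = snd p then -1 else 0)"

definition sign_vec :: "real^'n \<Rightarrow> real^'m \<Rightarrow> real^('n \<times> 'm)" where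
  "sign_vec x y = (\<chi> p. sgn ((Omega *v stack x y) $ p))"

definition Theta :: "real^('n::finite \<times> 'm::finite) \<Rightarrow> real^('n + 'm)^('n \<times> 'm)" where
  "Theta s = (\<chi> p c. s $ p * Omega $ p $ c)"

definition cost :: "real^'n \<Rightarrow> real^'m \<Rightarrow> real^('n \<times> 'm)" where
  "cost x y = Theta (sign_vec x y) *v stack x y"

lemma cost_nth: "cost x y $ (i, j) = \<bar>x $ i - y $ j\<bar>"
proof -
  have sum_Plus: "(\<Sum>c\<in>UNIV. f c) = (\<Sum>i\<in>UNIV. f (Inl i)) + (\<Sum>j\<in>UNIV. f (Inr j))"
    for f :: "'a + 'b \<Rightarrow> real"
    by (simp add: UNIV_Plus_UNIV[symmetric] sum.Plus del: UNIV_Plus_UNIV)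
  have if_app: "(if b then f else g) z = (if b then f z else g z)"
    for b and f g :: "real \<Rightarrow> real" and z
    by simp
  have Om: "(Omega *v stack x y) $ (i, j) = x $ i - y $ j"
    by (simp add: matrix_vector_mult_def Omega_def stack_def sum_Plus if_distrib if_app
        cong: if_cong)
  have "cost x y $ (i, j) = sgn (x $ i - y $ j) * (Omega *v stack x y) $ (i, j)"
    by (simp add: cost_def Theta_def sign_vec_def Om matrix_vector_mult_def
        sum_distrib_left mult.assoc flip: Om)
  then show ?thesis
    by (simp add: Om abs_sgn mult.commute)
qed

section \<open>The transport linear program\<close>

definition constraint_mat :: "real^('n \<times> 'm)^('n::finite + 'm::finite)" where
  "constraint_mat = (\<chi> r p.
     case r of
       Inl i \<Rightarrow> if fst p = i then 1 else 0
     | Inr j \<Rightarrow> if snd p = j then 1 else 0)"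

definition constraint_rhs :: "real^('n::finite + 'm::finite)" where
  "constraint_rhs = (\<chi> r.
     case r of
       Inl i \<Rightarrow> 1 / real CARD('n)
     | Inr j \<Rightarrow> 1 / real CARD('m))"

text \<open>
  The matrix S and the vector h of the program are the restrictions of
  \<^const>\<open>constraint_mat\<close> and \<^const>\<open>constraint_rhs\<close> to the rows in \<open>kept_rows\<close>.
\<close>

definition kept_rows :: "('n::finite + 'm::{finite,linorder}) set" where
  "kept_rows = UNIV - {Inr (Max UNIV)}"

definition lp_feasible :: "real^('n::finite \<times> 'm::{finite,linorder}) \<Rightarrow> bool" where
  "lp_feasible t \<longleftrightarrow>
     (\<forall>r\<in>kept_rows. (constraint_mat *v t) $ r = constraint_rhs $ r) \<and> (\<forall>p. 0 \<le> t $ p)"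

definition lp_optimal ::
    "real^'n::finite \<Rightarrow> real^'m::{finite,linorder} \<Rightarrow> real^('n::finite \<times> 'm::{finite,linorder}) \<Rightarrow> bool" where
  "lp_optimal x y t \<longleftrightarrow>
     lp_feasible t \<and> (\<forall>t'. lp_feasible t' \<longrightarrow> t \<bullet> cost x y \<le> t' \<bullet> cost x y)"

text \<open>
  Two-sided inverse of the submatrix of A with rows R and columns C, whose inverse has rows C
  and columns R; entries outside these index sets are irrelevant.
\<close>

definition is_submatrix_inv ::
    "'r set \<Rightarrow> 'c set \<Rightarrow> real^'c^'r \<Rightarrow> real^'r^'c \<Rightarrow> bool" where
  "is_submatrix_inv R C A B \<longleftrightarrow>
     (\<forall>r\<in>R. \<forall>r'\<in>R. (\<Sum>c\<in>C. A $ r $ c * B $ c $ r') = (if r = r' then 1 else 0)) \<and>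
     (\<forall>c\<in>C. \<forall>c'\<in>C. (\<Sum>r\<in>R. B $ c $ r * A $ r $ c') = (if c = c' then 1 else 0))"

definition submatrix_inv :: "'r set \<Rightarrow> 'c set \<Rightarrow> real^'c^'r \<Rightarrow> real^'r^'c" where
  "submatrix_inv R C A = (SOME B. is_submatrix_inv R C A B)"

definition lp_basis :: "('n::finite \<times> 'm::{finite,linorder}) set \<Rightarrow> bool" where
  "lp_basis J \<longleftrightarrow>
     card J = CARD('n) + CARD('m) - 1 \<and>
     (\<exists>B. is_submatrix_inv kept_rows J constraint_mat B)"

text \<open>
  The entries with index in J form the vector S_J^{-1} h of values of the basic variables; the
  remaining (nonbasic) variables are 0.
\<close>

definition basic_solution ::
    "('n::finite \<times> 'm::{finite,linorder}) set \<Rightarrow> real^('n \<times> 'm)" where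
  "basic_solution J = (\<chi> p.
     if p \<in> J
     then \<Sum>r\<in>kept_rows. submatrix_inv kept_rows J constraint_mat $ p $ r * constraint_rhs $ r
     else 0)"

definition optimal_basis ::
    "real^'n::finite \<Rightarrow> real^'m::{finite,linorder} \<Rightarrow> ('n::finite \<times> 'm::{finite,linorder}) set \<Rightarrow> bool" where
  "optimal_basis x y J \<longleftrightarrow> lp_basis J \<and> lp_optimal x y (basic_solution J)"

text \<open>
  Non-degeneracy: at every basic feasible solution all basic variables are nonzero. The feasible
  set, hence this condition, depends only on the two sample sizes and not on the data.
\<close>

definition lp_nondegenerate ::
    "'n::finite itself \<Rightarrow> 'm::{finite,linorder} itself \<Rightarrow> bool" where
  "lp_nondegenerate _ _ \<longleftrightarrow>
     (\<forall>J :: ('n \<times> 'm) set. lp_basis J \<longrightarrow> lp_feasible (basic_solution J) \<longrightarrow>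
        (\<forall>p\<in>J. basic_solution J $ p \<noteq> 0))"

section \<open>Test direction, truncation region and selective confidence interval\<close>

definition test_direction ::
    "real^('n \<times> 'm) \<Rightarrow> ('n::finite \<times> 'm::{finite,linorder}) set \<Rightarrow> real^('n + 'm)" where
  "test_direction s J = (\<Sum>p\<in>J. (basic_solution J $ p) *\<^sub>R (Theta s $ p))"

definition dir_b :: "real^'k^'k \<Rightarrow> real^'k \<Rightarrow> real^'k" where
  "dir_b \<Sigma> \<eta> = (1 / (\<eta> \<bullet> (\<Sigma> *v \<eta>))) *\<^sub>R (\<Sigma> *v \<eta>)"

definition nuisance :: "real^'k^'k \<Rightarrow> real^'k \<Rightarrow> real^'k \<Rightarrow> real^'k" where
  "nuisance \<Sigma> \<eta> v = (mat 1 - (\<chi> k l. dir_b \<Sigma> \<eta> $ k * \<eta> $ l)) *v v"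

definition trunc_region ::
    "(real^'n \<Rightarrow> real^'m \<Rightarrow> ('n \<times> 'm) set) \<Rightarrow> real^('n::finite + 'm::finite)^('n + 'm) \<Rightarrow> real^('n + 'm) \<Rightarrow>
     real^('n \<times> 'm) \<Rightarrow> ('n \<times> 'm) set \<Rightarrow> real^'n \<Rightarrow> real^'m \<Rightarrow> real set" where
  "trunc_region basis \<Sigma> \<eta> s J x y =
     {z. let v = nuisance \<Sigma> \<eta> (stack x y) + z *\<^sub>R dir_b \<Sigma> \<eta>
         in sign_vec (block1 v) (block2 v) = s \<and> basis (block1 v) (block2 v) = J}"

text \<open>Note that the second parameter of \<^const>\<open>normal_density\<close> is the standard deviation.\<close>

definition trunc_normal_cdf :: "real \<Rightarrow> real \<Rightarrow> real set \<Rightarrow> real \<Rightarrow> real" where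
  "trunc_normal_cdf w v Z =
     cdf (uniform_measure (density lborel (\<lambda>u. ennreal (normal_density w (sqrt v) u))) Z)"

definition selective_ci ::
    "real \<Rightarrow> (real^'n::finite \<Rightarrow> real^'m::{finite,linorder} \<Rightarrow> ('n \<times> 'm) set) \<Rightarrow> real^('n + 'm)^('n + 'm) \<Rightarrow>
     real^('n \<times> 'm) \<Rightarrow> ('n::finite \<times> 'm::{finite,linorder}) set \<Rightarrow>
     real^'n::finite \<Rightarrow> real^'m::{finite,linorder} \<Rightarrow> real set" where
  "selective_ci \<alpha> basis \<Sigma> s J x y =
     (let \<eta> = test_direction s J;
          F = (\<lambda>w. trunc_normal_cdf w (\<eta> \<bullet> (\<Sigma> *v \<eta>)) (trunc_region basis \<Sigma> \<eta> s J x y)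
                     (\<eta> \<bullet> stack x y))
      in {w. \<alpha> / 2 \<le> F w \<and> F w \<le> 1 - \<alpha> / 2})"

end

theory Submission
  imports Defs
begin

text \<open>
  Write the stacked vector as \<open>V = \<mu> + L g\<close> with \<open>g\<close> standard normal and \<open>\<eta> \<bullet> L g = a \<bullet> g\<close>. Replacing the
  component of \<open>g\<close> along \<open>a\<close> by an independent standard normal variable does not change its law. The
  nuisance vector depends only on the remaining components, so given these the truncation region is a
  fixed set \<open>Z\<close> while \<open>\<eta> \<bullet> V\<close> is normal with mean \<open>W\<^sup>*\<close>, and the conditioning event says exactly that
  \<open>\<eta> \<bullet> V\<close> lies in \<open>Z\<close>. The continuous c.d.f. of the truncated normal distribution is then uniformly
  distributed, so the coverage holds for every value of the nuisance vector, hence on average.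
\<close>

section \<open>The probability integral transform\<close>

text \<open>Without atoms the c.d.f. is continuous, and its values under \<open>M\<close> are
  uniform on [0, 1]. It may be constant on intervals, so no inverse is used: a point
  \<open>s\<close> with \<open>cdf M s = c\<close> places \<open>{..s}\<close>, of mass
  \<open>c\<close>, between \<open>{x. cdf M x < c}\<close> and \<open>{x. cdf M x \<le> c}\<close>,
  and neighbouring levels supply the two opposite bounds.\<close>

lemma (in real_distribution) measure_cdf_between:
  assumes atomless: "\<And>x. measure M {x} = 0" and \<alpha>: "0 \<le> \<alpha>" "\<alpha> \<le> 1"
  shows "measure M {x. \<alpha> / 2 \<le> cdf M x \<and> cdf M x \<le> 1 - \<alpha> / 2} = 1 - \<alpha>"
proof -
  have cont: "isCont (cdf M) x" for x
    using atomless isCont_cdf by simp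
  then have [measurable]: "cdf M \<in> borel_measurable borel"
    by (intro borel_measurable_continuous_onI) (simp add: continuous_on_eq_continuous_at)
  have meas: "Measurable.pred borel Q \<Longrightarrow> {x. Q x} \<in> sets M" for Q
    by (auto simp: pred_def)
  \<comment> \<open>Interior levels only: the values 0 and 1 may be attained nowhere, so the bounds
    below treat them apart.\<close>
  have quantile: "\<exists>s. cdf M s = c" if c: "0 < c" "c < 1" for c
  proof -
    obtain l where l: "cdf M l < c"
      using order_tendstoD(2)[OF cdf_lim_at_bot c(1)] by (auto dest: eventually_happens'[OF trivial_limit_at_bot_linorder])
    obtain r where r: "c < cdf M r"
      using order_tendstoD(1)[OF cdf_lim_at_top_prob c(2)] by (auto dest: eventually_happens'[OF trivial_limit_at_top_linorder])
    have "l \<le> r"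
      using l r cdf_nondecreasing[of r l] by linarith
    then show ?thesis
      using IVT[of "cdf M" l c r] l r cont by auto
  qed
  have less_le: "measure M {x. cdf M x < c} \<le> c" if c: "0 < c" "c \<le> 1" for c
  proof (cases "c = 1")
    case False
    then obtain s where s: "cdf M s = c"
      using quantile c by force
    then have "x \<le> s" if "cdf M x < c" for x
      using cdf_nondecreasing[of s x] that by linarith
    then have "measure M {x. cdf M x < c} \<le> measure M {..s}"
      by (intro finite_measure_mono) auto
    then show ?thesis
      using s by (simp add: cdf_def)
  qed simp
  have le_ge: "c \<le> measure M {x. cdf M x \<le> c}" if c: "0 \<le> c" "c < 1" for c
  proof (cases "c = 0")
    case False
    then obtain s where s: "cdf M s = c"
      using quantile c by force
    have "measure M {..s} \<le> measure M {x. cdf M x \<le> c}"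
      using s cdf_nondecreasing by (intro finite_measure_mono meas) auto
    then show ?thesis
      using s by (simp add: cdf_def)
  qed simp
  \<comment> \<open>For every \<open>d > c\<close> the set \<open>{x. cdf M x \<le> c}\<close> lies
    in \<open>{x. cdf M x < d}\<close>; let \<open>d\<close> decrease to \<open>c\<close>.
    \<open>less_ge\<close> is the mirror image, from below.\<close>
  have le_le: "measure M {x. cdf M x \<le> c} \<le> c" if c: "0 \<le> c" "c \<le> 1" for c
  proof (cases "c = 1")
    case False
    show ?thesis
    proof (rule dense_ge_bounded)
      show "c < 1"
        using c False by simp
      fix d assume "c < d" "d < 1"
      then have "measure M {x. cdf M x \<le> c} \<le> measure M {x. cdf M x < d}"
        by (intro finite_measure_mono meas) auto
      then show "measure M {x. cdf M x \<le> c} \<le> d"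
        using less_le[of d] c \<open>c < d\<close> \<open>d < 1\<close> by simp
    qed
  qed simp
  have less_ge: "c \<le> measure M {x. cdf M x < c}" if c: "0 \<le> c" "c \<le> 1" for c
  proof (cases "c = 0")
    case False
    show ?thesis
    proof (rule dense_le_bounded)
      show "0 < c"
        using c False by simp
      fix d assume "0 < d" "d < c"
      then have "measure M {x. cdf M x \<le> d} \<le> measure M {x. cdf M x < c}"
        by (intro finite_measure_mono meas) auto
      then show "d \<le> measure M {x. cdf M x < c}"
        using le_ge[of d] c \<open>0 < d\<close> \<open>d < c\<close> by simp
    qed
  qed simp
  \<comment> \<open>At \<alpha> = 0 the two levels are 1 and 0, which \<open>le_ge\<close> and
    \<open>less_le\<close> leave out; there the sets are the whole space and the empty set.\<close>
  have le_eq: "measure M {x. cdf M x \<le> 1 - \<alpha> / 2} = 1 - \<alpha> / 2"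
  proof (cases "\<alpha> = 0")
    case True
    then have "{x. cdf M x \<le> 1 - \<alpha> / 2} = space M"
      using cdf_bounded_prob by auto
    then show ?thesis
      using True by (simp only: prob_space)
  next
    case False
    then show ?thesis
      using le_le[of "1 - \<alpha> / 2"] le_ge[of "1 - \<alpha> / 2"] \<alpha> by simp
  qed
  have less_eq: "measure M {x. cdf M x < \<alpha> / 2} = \<alpha> / 2"
  proof (cases "\<alpha> = 0")
    case True
    then show ?thesis
      using cdf_nonneg by (simp add: not_less[symmetric])
  next
    case False
    then show ?thesis
      using less_le[of "\<alpha> / 2"] less_ge[of "\<alpha> / 2"] \<alpha> by simp
  qed
  have "{x. \<alpha> / 2 \<le> cdf M x \<and> cdf M x \<le> 1 - \<alpha> / 2}
      = {x. cdf M x \<le> 1 - \<alpha> / 2} - {x. cdf M x < \<alpha> / 2}"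
    by auto
  also have "measure M \<dots> = measure M {x. cdf M x \<le> 1 - \<alpha> / 2} - measure M {x. cdf M x < \<alpha> / 2}"
    using \<alpha> by (intro finite_measure_Diff meas) auto
  also have "\<dots> = 1 - \<alpha>"
    unfolding le_eq less_eq by simp
  finally show ?thesis .
qed

text \<open>Multiplying through by the mass of \<open>Z\<close> makes the identity hold for null
  \<open>Z\<close> too; such sets can arise as truncation sets for single values of the nuisance
  vector. For other \<open>Z\<close> the normalised restriction inherits atomlessness from
  \<open>N\<close>, and the integral transform applies to it.\<close>

lemma emeasure_cdf_uniform_measure_between:
  fixes N :: "real measure"
  assumes N: "prob_space N" "sets N = sets borel" and atomless: "\<And>x. emeasure N {x} = 0"
    and Z: "Z \<in> sets borel" and \<alpha>: "0 \<le> \<alpha>" "\<alpha> \<le> 1"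
  shows "emeasure N (Z \<inter> {t. \<alpha> / 2 \<le> cdf (uniform_measure N Z) t \<and>
           cdf (uniform_measure N Z) t \<le> 1 - \<alpha> / 2}) = ennreal (1 - \<alpha>) * emeasure N Z"
    (is "emeasure N (Z \<inter> ?C) = _")
proof (cases "emeasure N Z = 0")
  case True
  then have "emeasure N (Z \<inter> ?C) \<le> 0"
    using emeasure_mono[of "Z \<inter> ?C" Z N] Z N by simp
  then show ?thesis
    using True by simp
next
  case False
  interpret N: prob_space N
    by fact
  interpret U: prob_space "uniform_measure N Z"
    using False by (intro prob_space_uniform_measure) auto
  interpret U: real_distribution "uniform_measure N Z"
    by unfold_locales (auto simp: N)
  have "emeasure N (Z \<inter> {x}) = 0" for x
    using emeasure_mono[of "Z \<inter> {x}" "{x}" N] atomless[of x] N by simp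
  then have atom: "measure (uniform_measure N Z) {x} = 0" for x
    using Z N by (simp add: measure_def)
  have "isCont (cdf (uniform_measure N Z)) x" for x
    using atom U.isCont_cdf by simp
  then have [measurable]: "cdf (uniform_measure N Z) \<in> borel_measurable borel"
    by (intro borel_measurable_continuous_onI) (simp add: continuous_on_eq_continuous_at)
  have C: "?C \<in> sets borel"
    by measurable
  have "ennreal (1 - \<alpha>) = emeasure (uniform_measure N Z) ?C"
    using U.measure_cdf_between[OF atom \<alpha>] by (simp add: U.emeasure_eq_measure)
  also have "\<dots> = emeasure N (Z \<inter> ?C) / emeasure N Z"
    using Z C N by (subst emeasure_uniform_measure) auto
  finally have "ennreal (1 - \<alpha>) * emeasure N Z = emeasure N (Z \<inter> ?C) / emeasure N Z * emeasure N Z"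
    by simp
  also have "\<dots> = emeasure N (Z \<inter> ?C)"
    using False by (simp only: ennreal_divide_times ennreal_divide_self N.emeasure_finite mult_1_right)
      (simp add: top.not_eq_extremum[symmetric])
  finally show ?thesis ..
qed

section \<open>Resampling a Gaussian vector along a direction\<close>

lemma nn_integral_lborel_translate:
  fixes f :: "'a::euclidean_space \<Rightarrow> ennreal"
  assumes [measurable]: "f \<in> borel_measurable borel"
  shows "(\<integral>\<^sup>+x. f (x + c) \<partial>lborel) = (\<integral>\<^sup>+x. f x \<partial>lborel)"
proof -
  have "(\<integral>\<^sup>+x. f x \<partial>lborel) = (\<integral>\<^sup>+x. f x \<partial>distr lborel borel ((+) c))"
    by (simp add: lborel_distr_plus)
  also have "\<dots> = (\<integral>\<^sup>+x. f (x + c) \<partial>lborel)"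
    by (subst nn_integral_distr) (simp_all add: add.commute)
  finally show ?thesis ..
qed

text \<open>
  On the plane spanned by \<open>(u, 0)\<close> and \<open>(0, 1)\<close> the map is the rotation by a right angle, which is
  a product of three shears; each of them preserves Lebesgue measure by Fubini and translation
  invariance.
\<close>

lemma nn_integral_lborel_quarter_turn:
  fixes h :: "'a::euclidean_space \<times> real \<Rightarrow> ennreal"
  assumes h: "h \<in> borel_measurable borel" and u: "norm u = 1"
  shows "(\<integral>\<^sup>+x. \<integral>\<^sup>+z. h (x - (u \<bullet> x) *\<^sub>R u + z *\<^sub>R u, - (u \<bullet> x)) \<partial>lborel \<partial>lborel)
       = (\<integral>\<^sup>+x. \<integral>\<^sup>+z. h (x, z) \<partial>lborel \<partial>lborel)"
proof -
  have meas: "f \<in> borel_measurable (lborel \<Otimes>\<^sub>M lborel)" if "f \<in> borel_measurable borel"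
    for f :: "'a \<times> real \<Rightarrow> ennreal"
    using that by (simp add: lborel_prod)
  have sec: "(\<lambda>x. f (x, z)) \<in> borel_measurable borel" "(\<lambda>z. f (x, z)) \<in> borel_measurable borel"
    if "f \<in> borel_measurable borel" for f :: "'a \<times> real \<Rightarrow> ennreal" and x z
    using that by (auto intro!: measurable_compose[OF _ that] borel_measurable_continuous_onI continuous_intros)
  have shear1: "(\<integral>\<^sup>+x. \<integral>\<^sup>+z. f (x + z *\<^sub>R u, z) \<partial>lborel \<partial>lborel) = (\<integral>\<^sup>+x. \<integral>\<^sup>+z. f (x, z) \<partial>lborel \<partial>lborel)"
    and m1: "(\<lambda>p. f (fst p + snd p *\<^sub>R u, snd p)) \<in> borel_measurable borel"
    if f: "f \<in> borel_measurable borel" for f :: "'a \<times> real \<Rightarrow> ennreal"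
  proof -
    show m: "(\<lambda>p. f (fst p + snd p *\<^sub>R u, snd p)) \<in> borel_measurable borel"
      by (intro measurable_compose[OF _ f] borel_measurable_continuous_onI continuous_intros)
    \<comment> \<open>After the exchange of integrals \<open>z\<close> is fixed, and the shear is a
      translation of \<open>x\<close>.\<close>
    have "(\<integral>\<^sup>+x. \<integral>\<^sup>+z. f (x + z *\<^sub>R u, z) \<partial>lborel \<partial>lborel) = (\<integral>\<^sup>+z. \<integral>\<^sup>+x. f (x + z *\<^sub>R u, z) \<partial>lborel \<partial>lborel)"
      using lborel_pair.Fubini'[of "\<lambda>x z. f (x + z *\<^sub>R u, z)"] meas[OF m] by (simp add: case_prod_beta')
    also have "\<dots> = (\<integral>\<^sup>+z. \<integral>\<^sup>+x. f (x, z) \<partial>lborel \<partial>lborel)"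
      using nn_integral_lborel_translate[OF sec(1)[OF f]] by simp
    also have "\<dots> = (\<integral>\<^sup>+x. \<integral>\<^sup>+z. f (x, z) \<partial>lborel \<partial>lborel)"
      using lborel_pair.Fubini'[of "\<lambda>x z. f (x, z)"] meas[OF f] by simp
    finally show "(\<integral>\<^sup>+x. \<integral>\<^sup>+z. f (x + z *\<^sub>R u, z) \<partial>lborel \<partial>lborel) = \<dots>" .
  qed
  have shear2: "(\<integral>\<^sup>+x. \<integral>\<^sup>+z. f (x, z - u \<bullet> x) \<partial>lborel \<partial>lborel) = (\<integral>\<^sup>+x. \<integral>\<^sup>+z. f (x, z) \<partial>lborel \<partial>lborel)"
    and m2: "(\<lambda>p. f (fst p, snd p - u \<bullet> fst p)) \<in> borel_measurable borel"
    if f: "f \<in> borel_measurable borel" for f :: "'a \<times> real \<Rightarrow> ennreal"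
  proof -
    show "(\<lambda>p. f (fst p, snd p - u \<bullet> fst p)) \<in> borel_measurable borel"
      by (intro measurable_compose[OF _ f] borel_measurable_continuous_onI continuous_intros)
    show "(\<integral>\<^sup>+x. \<integral>\<^sup>+z. f (x, z - u \<bullet> x) \<partial>lborel \<partial>lborel) = (\<integral>\<^sup>+x. \<integral>\<^sup>+z. f (x, z) \<partial>lborel \<partial>lborel)"
      using nn_integral_lborel_translate[OF sec(2)[OF f], of _ "- (u \<bullet> _)"] by simp
  qed
  have uu: "u \<bullet> u = 1"
    using u by (simp add: dot_square_norm)
  \<comment> \<open>On the pair \<open>(u \<bullet> x, z)\<close> the three shears compose to (s, t)
    \<mapsto> (t, -s); the component of \<open>x\<close> orthogonal to \<open>u\<close> stays
    put.\<close>
  have "(\<integral>\<^sup>+x. \<integral>\<^sup>+z. h (x, z) \<partial>lborel \<partial>lborel) = (\<integral>\<^sup>+x. \<integral>\<^sup>+z. h (x + z *\<^sub>R u, z) \<partial>lborel \<partial>lborel)"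
    using shear1[OF h] ..
  also have "\<dots> = (\<integral>\<^sup>+x. \<integral>\<^sup>+z. h (x + (z - u \<bullet> x) *\<^sub>R u, z - u \<bullet> x) \<partial>lborel \<partial>lborel)"
    using shear2[OF m1[OF h]] by simp
  also have "\<dots> = (\<integral>\<^sup>+x. \<integral>\<^sup>+z. h (x + z *\<^sub>R u + (z - u \<bullet> (x + z *\<^sub>R u)) *\<^sub>R u, z - u \<bullet> (x + z *\<^sub>R u)) \<partial>lborel \<partial>lborel)"
    using shear1[OF m2[OF m1[OF h]]] by simp
  also have "\<dots> = (\<integral>\<^sup>+x. \<integral>\<^sup>+z. h (x - (u \<bullet> x) *\<^sub>R u + z *\<^sub>R u, - (u \<bullet> x)) \<partial>lborel \<partial>lborel)"
    by (simp add: uu inner_add_right algebra_simps)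
  finally show ?thesis ..
qed

text \<open>The constant is left free, so that one family covers the standard normal law on each
  block and on the product of the blocks.\<close>

definition gauss_measure :: "real \<Rightarrow> 'a::euclidean_space measure" where
  "gauss_measure c = density lborel (\<lambda>x. ennreal (c * exp (- (norm x)\<^sup>2 / 2)))"

lemma sets_gauss_measure [measurable_cong, simp]: "sets (gauss_measure c) = sets borel"
  by (simp add: gauss_measure_def)

text \<open>Adjoin an independent standard normal \<open>z\<close>. The joint density of
  \<open>(x, z)\<close> depends only on the sum of squares, which the quarter turn preserves, and
  the turn puts \<open>z\<close> in place of the component \<open>u \<bullet> x\<close>.\<close>

lemma nn_integral_gauss_measure_resample:
  fixes f :: "'a::euclidean_space \<Rightarrow> ennreal"
  assumes f [measurable]: "f \<in> borel_measurable borel" and u: "norm u = 1" and c: "0 \<le> c"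
  shows "(\<integral>\<^sup>+x. f x \<partial>gauss_measure c)
       = (\<integral>\<^sup>+x. \<integral>\<^sup>+z. f (x - (u \<bullet> x) *\<^sub>R u + z *\<^sub>R u) \<partial>density lborel std_normal_density \<partial>gauss_measure c)"
proof -
  define k where "k x = ennreal (c * exp (- (norm x)\<^sup>2 / 2))" for x :: 'a
  have k [measurable]: "k \<in> borel_measurable borel"
    unfolding k_def by measurable
  define \<phi> where "\<phi> z = ennreal (std_normal_density z)" for z
  have \<phi> [measurable]: "\<phi> \<in> borel_measurable borel"
    unfolding \<phi>_def by measurable
  have \<phi>1: "(\<integral>\<^sup>+z. \<phi> z \<partial>lborel) = 1"
    using prob_space.emeasure_space_1[OF prob_space_normal_density[of 1 0]]
    by (simp add: emeasure_density \<phi>_def)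
  define h where "h p = k (fst p) * \<phi> (snd p) * f (fst p)" for p :: "'a \<times> real"
  have h: "h \<in> borel_measurable borel"
    unfolding h_def borel_prod[symmetric] by measurable
  have uu: "u \<bullet> u = 1"
    using u by (simp add: dot_square_norm)
  have weight: "k (x - (u \<bullet> x) *\<^sub>R u + z *\<^sub>R u) * \<phi> (- (u \<bullet> x)) = k x * \<phi> z" for x z
  proof -
    have "(norm (x - (u \<bullet> x) *\<^sub>R u + z *\<^sub>R u))\<^sup>2 + (u \<bullet> x)\<^sup>2 = (norm x)\<^sup>2 + z\<^sup>2"
      unfolding power2_norm_eq_inner
      by (simp add: inner_simps uu inner_commute[of u x] power2_eq_square algebra_simps)
    then have "exp (- (norm (x - (u \<bullet> x) *\<^sub>R u + z *\<^sub>R u))\<^sup>2 / 2) * exp (- (u \<bullet> x)\<^sup>2 / 2)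
        = exp (- (norm x)\<^sup>2 / 2) * exp (- z\<^sup>2 / 2)"
      unfolding exp_add[symmetric] by (simp add: field_simps)
    then show ?thesis
      using c by (simp add: k_def \<phi>_def std_normal_density_def ennreal_mult'[symmetric])
  qed
  \<comment> \<open>\<open>f\<close> does not see the adjoined coordinate, whose density integrates
    to 1.\<close>
  have "(\<integral>\<^sup>+x. f x \<partial>gauss_measure c) = (\<integral>\<^sup>+x. \<integral>\<^sup>+z. h (x, z) \<partial>lborel \<partial>lborel)"
    unfolding gauss_measure_def k_def[symmetric] h_def
    by (subst nn_integral_density) (simp_all add: nn_integral_multc nn_integral_cmult \<phi>1)
  also have "\<dots> = (\<integral>\<^sup>+x. \<integral>\<^sup>+z. k x * (\<phi> z * f (x - (u \<bullet> x) *\<^sub>R u + z *\<^sub>R u)) \<partial>lborel \<partial>lborel)"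
    using nn_integral_lborel_quarter_turn[OF h u] by (simp add: h_def weight mult.assoc[symmetric])
  also have "\<dots> = (\<integral>\<^sup>+x. k x * (\<integral>\<^sup>+z. \<phi> z * f (x - (u \<bullet> x) *\<^sub>R u + z *\<^sub>R u) \<partial>lborel) \<partial>lborel)"
    by (subst nn_integral_cmult) simp_all
  also have "\<dots> = (\<integral>\<^sup>+x. \<integral>\<^sup>+z. f (x - (u \<bullet> x) *\<^sub>R u + z *\<^sub>R u) \<partial>density lborel std_normal_density \<partial>gauss_measure c)"
    unfolding gauss_measure_def k_def[symmetric]
    by (subst nn_integral_density) (simp_all add: nn_integral_density \<phi>_def[symmetric])
  finally show ?thesis .
qed

section \<open>Normal laws on the line and measurability of the truncated c.d.f\<close>

lemma emeasure_std_normal_affine: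
  fixes w \<sigma> :: real
  assumes \<sigma>: "0 < \<sigma>" and A: "A \<in> sets borel"
  shows "(\<integral>\<^sup>+z. indicator A (w + \<sigma> * z) \<partial>density lborel std_normal_density)
       = emeasure (density lborel (normal_density w \<sigma>)) A"
proof -
  interpret prob_space "density lborel std_normal_density"
    by (rule prob_space_normal_density) simp
  \<comment> \<open>The identity is a standard normal variable under its own law, which brings
    \<open>normal_density_affine\<close> into play.\<close>
  have "distributed (density lborel std_normal_density) lborel (\<lambda>x. x) std_normal_density"
    unfolding distributed_def by (auto simp: distr_id2)
  from normal_density_affine[OF this, of \<sigma> w] \<sigma>
  have "distr (density lborel std_normal_density) lborel (\<lambda>z. w + \<sigma> * z)
      = density lborel (normal_density w \<sigma>)"
    by (simp add: distributed_def)
  then have "emeasure (density lborel (normal_density w \<sigma>)) A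
      = (\<integral>\<^sup>+x. indicator A x \<partial>distr (density lborel std_normal_density) lborel (\<lambda>z. w + \<sigma> * z))"
    using A by simp
  also have "\<dots> = (\<integral>\<^sup>+z. indicator A (w + \<sigma> * z) \<partial>density lborel std_normal_density)"
    using A by (subst nn_integral_distr) auto
  finally show ?thesis ..
qed

text \<open>Both the truncation set and the point of evaluation vary with \<open>v\<close>. The
  c.d.f. is a quotient of the measures of two sections of Borel sets in the product, and these
  depend measurably on \<open>v\<close> because \<open>N\<close> is sigma-finite.\<close>

lemma borel_measurable_cdf_uniform_measure:
  fixes N :: "real measure" and E :: "'v::second_countable_topology set"
    and g :: "'u::second_countable_topology \<Rightarrow> real \<Rightarrow> 'v"
  assumes N: "sigma_finite_measure N" "sets N = sets borel"
    and E: "E \<in> sets borel" and g: "(\<lambda>(v, z). g v z) \<in> borel_measurable borel"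
    and T: "T \<in> borel_measurable borel"
  shows "(\<lambda>v. cdf (uniform_measure N {z. g v z \<in> E}) (T v)) \<in> borel_measurable borel"
proof -
  interpret sigma_finite_measure N
    by fact
  have gm [measurable]: "(\<lambda>p. g (fst p) (snd p)) \<in> borel_measurable (borel \<Otimes>\<^sub>M borel)"
    using g by (simp add: case_prod_beta' borel_prod)
  note E [measurable] T [measurable]
  have sec: "{z. g v z \<in> E} \<in> sets borel" for v
  proof -
    have [measurable]: "g v \<in> borel_measurable borel"
      using measurable_compose[OF measurable_Pair1' gm, of v] by simp
    show ?thesis
      by measurable
  qed
  have setsN [measurable_cong]: "sets N = sets borel"
    by fact
  have 1: "(\<lambda>v. emeasure N {z. g v z \<in> E \<and> z \<le> T v}) \<in> borel_measurable borel"
  proof -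
    have "Measurable.pred (borel \<Otimes>\<^sub>M borel) (\<lambda>p. g (fst p) (snd p) \<in> E \<and> snd p \<le> T (fst p))"
      by measurable
    then have "{p. g (fst p) (snd p) \<in> E \<and> snd p \<le> T (fst p)} \<in> sets (borel \<Otimes>\<^sub>M N)"
      by (simp add: sets_pair_measure_cong[OF refl N(2)] pred_def space_pair_measure)
    from measurable_emeasure_Pair[OF this] show ?thesis
      by (simp add: vimage_def)
  qed
  have 2: "(\<lambda>v. emeasure N {z. g v z \<in> E}) \<in> borel_measurable borel"
  proof -
    have "Measurable.pred (borel \<Otimes>\<^sub>M borel) (\<lambda>p. g (fst p) (snd p) \<in> E)"
      by measurable
    then have "{p. g (fst p) (snd p) \<in> E} \<in> sets (borel \<Otimes>\<^sub>M N)"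
      by (simp add: sets_pair_measure_cong[OF refl N(2)] pred_def space_pair_measure)
    from measurable_emeasure_Pair[OF this] show ?thesis
      by (simp add: vimage_def)
  qed
  \<comment> \<open>This covers null sections: both sides are 0 there, as 0 / 0 = 0 in
    \<open>ennreal\<close>.\<close>
  have "cdf (uniform_measure N {z. g v z \<in> E}) (T v)
      = enn2real (emeasure N {z. g v z \<in> E \<and> z \<le> T v} / emeasure N {z. g v z \<in> E})" for v
  proof -
    have "{z. g v z \<in> E} \<inter> {..T v} = {z. g v z \<in> E \<and> z \<le> T v}"
      by auto
    then show ?thesis
      using sec[of v] by (simp add: cdf_def measure_def N)
  qed
  then show ?thesis
    using 1 2 by simp
qed

text \<open>
  Given a value \<open>v\<close> of a Gaussian vector \<open>v\<^sub>0 + L g\<close>, resampling \<open>g\<close> along \<open>a\<close> moves \<open>v\<close> along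
  \<open>b\<close> while \<open>v - (\<eta> \<bullet> v) *\<^sub>R b\<close> stays fixed, and \<open>\<eta> \<bullet> v\<close> is then a fresh normal variable.
\<close>

lemma gauss_truncated_coverage:
  fixes L :: "'e::euclidean_space \<Rightarrow> 'k::euclidean_space" and \<eta> v\<^sub>0 :: 'k and a :: 'e
  assumes L: "linear L" and a: "\<And>g. \<eta> \<bullet> L g = a \<bullet> g" and a0: "a \<noteq> 0" and c: "0 \<le> c"
    and E: "E \<in> sets borel" and \<alpha>: "0 \<le> \<alpha>" "\<alpha> \<le> 1"
  defines "b \<equiv> (1 / (norm a)\<^sup>2) *\<^sub>R L a"
  defines "F \<equiv> (\<lambda>v. cdf (uniform_measure (density lborel (normal_density (\<eta> \<bullet> v\<^sub>0) (norm a)))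
                       {z. v - (\<eta> \<bullet> v) *\<^sub>R b + z *\<^sub>R b \<in> E}) (\<eta> \<bullet> v))"
  defines "C \<equiv> {v. \<alpha> / 2 \<le> F v \<and> F v \<le> 1 - \<alpha> / 2}"
  shows "C \<in> sets borel"
    and "emeasure (distr (gauss_measure c) borel (\<lambda>g. v\<^sub>0 + L g)) (E \<inter> C)
       = ennreal (1 - \<alpha>) * emeasure (distr (gauss_measure c) borel (\<lambda>g. v\<^sub>0 + L g)) E"
proof -
  \<comment> \<open>For standard normal \<open>g\<close>, the statistic
    \<open>\<eta> \<bullet> (v\<^sub>0 + L g)\<close> has mean \<open>w\<close> and standard
    deviation \<open>\<sigma>\<close>; \<open>u\<close> is the only direction of \<open>g\<close> on
    which it depends.\<close>
  define \<sigma> where "\<sigma> = norm a"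
  define u where "u = (1 / \<sigma>) *\<^sub>R a"
  define w where "w = \<eta> \<bullet> v\<^sub>0"
  define N where "N = density lborel (\<lambda>x. ennreal (normal_density w \<sigma> x))"
  have \<sigma>: "0 < \<sigma>" and u: "norm u = 1" and aa: "a \<bullet> a = \<sigma>\<^sup>2"
    using a0 by (auto simp: \<sigma>_def u_def dot_square_norm)
  have au: "a \<bullet> u = \<sigma>" and aux: "a \<bullet> x = \<sigma> * (u \<bullet> x)" for x
    using \<sigma> by (simp_all add: u_def aa power2_eq_square)
  have uu: "u \<bullet> u = 1"
    using u by (simp add: dot_square_norm)
  interpret N: prob_space N
    unfolding N_def by (rule prob_space_normal_density) fact
  have setsN: "sets N = sets borel"
    by (simp add: N_def)
  have atomless: "emeasure N {x} = 0" for x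
    by (simp add: N_def emeasure_density nn_integral_null_set)
  \<comment> \<open>A step \<open>z\<close> along \<open>u\<close> in the noise becomes
    \<open>\<sigma> * z\<close> along \<open>b\<close>; since \<open>\<eta> \<bullet> b = 1\<close>,
    moving by \<open>t *\<^sub>R b\<close> raises the statistic by exactly \<open>t\<close>.\<close>
  have Lu: "L u = \<sigma> *\<^sub>R b"
    using \<sigma> by (simp add: u_def b_def linear_scale[OF L] power2_eq_square flip: \<sigma>_def)
  have \<eta>b: "\<eta> \<bullet> b = 1"
    using \<sigma> by (simp add: b_def a aa flip: \<sigma>_def)
  have Lm [measurable]: "L \<in> borel_measurable borel"
    using L by (simp add: linear_conv_bounded_linear borel_measurable_continuous_onI
        linear_continuous_on)
  have "(\<lambda>(v, z). v - (\<eta> \<bullet> v) *\<^sub>R b + z *\<^sub>R b) \<in> borel_measurable borel"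
    unfolding case_prod_beta' by (intro borel_measurable_continuous_onI continuous_intros)
  then have Fm [measurable]: "F \<in> borel_measurable borel"
    unfolding F_def using E setsN N.sigma_finite_measure_axioms
    by (intro borel_measurable_cdf_uniform_measure) (auto simp: N_def w_def \<sigma>_def)
  show C [measurable]: "C \<in> sets borel"
    unfolding C_def by measurable
  note E [measurable]
  define V where "V x z = v\<^sub>0 + L (x - (u \<bullet> x) *\<^sub>R u + z *\<^sub>R u)" for x z
  have law: "emeasure (distr (gauss_measure c) borel (\<lambda>g. v\<^sub>0 + L g)) D
      = (\<integral>\<^sup>+x. \<integral>\<^sup>+z. indicator D (V x z) \<partial>density lborel std_normal_density \<partial>gauss_measure c)"
    if D [measurable]: "D \<in> sets borel" for D
  proof -
    have "emeasure (distr (gauss_measure c) borel (\<lambda>g. v\<^sub>0 + L g)) D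
        = (\<integral>\<^sup>+v. indicator D v \<partial>distr (gauss_measure c) borel (\<lambda>g. v\<^sub>0 + L g))"
      by simp
    also have "\<dots> = (\<integral>\<^sup>+x. indicator D (v\<^sub>0 + L x) \<partial>gauss_measure c)"
      by (subst nn_integral_distr) simp_all
    also have "\<dots> = (\<integral>\<^sup>+x. \<integral>\<^sup>+z. indicator D (V x z) \<partial>density lborel std_normal_density \<partial>gauss_measure c)"
      unfolding V_def using u c by (intro nn_integral_gauss_measure_resample) simp_all
    finally show ?thesis .
  qed
  \<comment> \<open>For fixed \<open>x\<close> the resampled vectors fill one line parallel to
    \<open>b\<close>. Coverage holds on each such line by the integral transform, and integrating
    over \<open>x\<close> gives the claim.\<close>
  have inner: "(\<integral>\<^sup>+z. indicator (E \<inter> C) (V x z) \<partial>density lborel std_normal_density)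
      = ennreal (1 - \<alpha>) * (\<integral>\<^sup>+z. indicator E (V x z) \<partial>density lborel std_normal_density)" for x
  proof -
    \<comment> \<open>Subtracting \<open>w *\<^sub>R b\<close> makes \<open>q\<close> the point of
      the line with \<open>\<eta> \<bullet> q = 0\<close>. The parameter of
      \<open>q + t *\<^sub>R b\<close> is then the statistic itself, and
      \<open>t = w + \<sigma> * z\<close> has law \<open>N\<close>.\<close>
    define q where "q = v\<^sub>0 + L (x - (u \<bullet> x) *\<^sub>R u) - w *\<^sub>R b"
    define Z where "Z = {t. q + t *\<^sub>R b \<in> E}"
    define K where "K = {t. \<alpha> / 2 \<le> cdf (uniform_measure N Z) t \<and> cdf (uniform_measure N Z) t \<le> 1 - \<alpha> / 2}"
    have V: "V x z = q + (w + \<sigma> * z) *\<^sub>R b" for z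
      unfolding V_def q_def linear_add[OF L] linear_scale[OF L] Lu by (simp add: algebra_simps)
    have \<eta>q: "\<eta> \<bullet> q = 0"
      by (simp add: q_def w_def inner_add_right inner_diff_right a \<eta>b au aux uu)
    \<comment> \<open>All points of the line have nuisance part \<open>q\<close>, so
      \<open>F\<close> truncates to the one set \<open>Z\<close> throughout.\<close>
    have F: "F (q + t *\<^sub>R b) = cdf (uniform_measure N Z) t" for t
      by (simp add: F_def inner_add_right \<eta>q \<eta>b Z_def N_def w_def \<sigma>_def)
    have Z [measurable]: "Z \<in> sets borel"
      unfolding Z_def by measurable
    have "K = {t. q + t *\<^sub>R b \<in> C}"
      by (simp add: K_def C_def F)
    also have "\<dots> \<in> sets borel"
      by measurable
    finally have K [measurable]: "K \<in> sets borel" .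
    have ind: "indicator (E \<inter> C) (V x z) = (indicator (Z \<inter> K) (w + \<sigma> * z) :: ennreal)"
      "indicator E (V x z) = (indicator Z (w + \<sigma> * z) :: ennreal)" for z
      by (auto simp: indicator_def V Z_def K_def C_def F)
    show ?thesis
      using emeasure_cdf_uniform_measure_between[OF N.prob_space_axioms setsN atomless Z \<alpha>, folded K_def]
      unfolding ind by (simp add: emeasure_std_normal_affine[OF \<sigma>] N_def[symmetric])
  qed
  have "(\<lambda>x. \<integral>\<^sup>+z. indicator E (V x z) \<partial>density lborel std_normal_density) \<in> borel_measurable (gauss_measure c)"
  proof -
    interpret S: prob_space "density lborel std_normal_density"
      by (rule prob_space_normal_density) simp
    show ?thesis
      unfolding V_def by measurable
  qed
  then show "emeasure (distr (gauss_measure c) borel (\<lambda>g. v\<^sub>0 + L g)) (E \<inter> C)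
      = ennreal (1 - \<alpha>) * emeasure (distr (gauss_measure c) borel (\<lambda>g. v\<^sub>0 + L g)) E"
    by (simp only: law[OF E] law[OF sets.Int[OF E C]] inner nn_integral_cmult)
qed

section \<open>Stacked vectors\<close>

lemma sum_UNIV_Plus:
  fixes f :: "'a::finite + 'b::finite \<Rightarrow> 'c::comm_monoid_add"
  shows "(\<Sum>k\<in>UNIV. f k) = (\<Sum>i\<in>UNIV. f (Inl i)) + (\<Sum>j\<in>UNIV. f (Inr j))"
  by (simp add: UNIV_Plus_UNIV[symmetric] sum.Plus del: UNIV_Plus_UNIV)

lemma stack_block [simp]: "stack (block1 v) (block2 v) = v"
  by (simp add: stack_def block1_def block2_def vec_eq_iff split: sum.split)

lemma block_stack [simp]: "block1 (stack x y) = x" "block2 (stack x y) = y"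
  by (simp_all add: stack_def block1_def block2_def vec_eq_iff)

lemma inner_stack: "v \<bullet> stack x y = block1 v \<bullet> x + block2 v \<bullet> y"
  by (simp add: inner_vec_def sum_UNIV_Plus stack_def block1_def block2_def)

lemma block_diag_mult: "block_diag A B *v v = stack (A *v block1 v) (B *v block2 v)"
  by (auto simp: vec_eq_iff matrix_vector_mult_def sum_UNIV_Plus stack_def block1_def block2_def
      block_diag_def split: sum.split)

lemma linear_stack: "linear (\<lambda>p. stack (fst p) (snd p))"
  by (rule linearI) (auto simp: stack_def vec_eq_iff split: sum.split)

lemma linear_block: "linear block1" "linear block2"
  by (auto intro!: linearI simp: block1_def block2_def vec_eq_iff)

lemma linear_borel_measurable:
  fixes f :: "'a::euclidean_space \<Rightarrow> 'b::euclidean_space"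
  shows "linear f \<Longrightarrow> f \<in> borel_measurable borel"
  by (simp add: linear_conv_bounded_linear borel_measurable_continuous_onI linear_continuous_on)

section \<open>Joint Gaussian law of an independent pair\<close>

lemma std_normal_vec_eq_gauss_measure:
  "(std_normal_vec :: (real^'n) measure) = gauss_measure ((1 / sqrt (2 * pi)) ^ CARD('n))"
proof -
  have "(\<Prod>i\<in>UNIV. std_normal_density (x $ i))
      = (1 / sqrt (2 * pi)) ^ CARD('n) * exp (- (norm x)\<^sup>2 / 2)" for x :: "real^'n"
    unfolding std_normal_density_def prod.distrib exp_sum[OF finite, symmetric] power2_norm_eq_inner
    by (simp add: inner_vec_def sum_negf sum_divide_distrib power2_eq_square)
  then show ?thesis
    by (simp add: std_normal_vec_def gauss_measure_def)
qed

text \<open>The norm on pairs is Euclidean: squared norms add, so the exponentials multiply.\<close>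

lemma pair_gauss_measure:
  assumes "sigma_finite_measure (gauss_measure d :: 'b::euclidean_space measure)" "0 \<le> c"
  shows "gauss_measure c \<Otimes>\<^sub>M gauss_measure d
       = (gauss_measure (c * d) :: ('a::euclidean_space \<times> 'b) measure)"
proof -
  have "ennreal (c * exp (- (norm x)\<^sup>2 / 2)) * ennreal (d * exp (- (norm y)\<^sup>2 / 2))
      = ennreal (c * d * exp (- (norm (x, y))\<^sup>2 / 2))" for x :: 'a and y :: 'b
  proof -
    have "- (norm (x, y))\<^sup>2 / 2 = - (norm x)\<^sup>2 / 2 + - (norm y)\<^sup>2 / 2"
      by (simp add: norm_Pair field_simps)
    then show ?thesis
      using assms(2) by (simp only: exp_add) (simp add: ennreal_mult'[symmetric] mult_ac)
  qed
  then show ?thesis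
    using assms(1) unfolding gauss_measure_def
    by (subst pair_measure_density) (simp_all add: lborel_prod lborel.sigma_finite_measure_axioms case_prod_beta')
qed

text \<open>By sigma-finiteness it suffices to compare the measures on rectangles, where
  independence of the two families of preimages is the product formula.\<close>

lemma (in prob_space) distr_Pair_indep_set:
  assumes X: "random_variable S X" and Y: "random_variable T Y"
    and ind: "indep_set {X -` A \<inter> space M | A. A \<in> sets S} {Y -` B \<inter> space M | B. B \<in> sets T}"
  shows "distr M S X \<Otimes>\<^sub>M distr M T Y = distr M (S \<Otimes>\<^sub>M T) (\<lambda>\<omega>. (X \<omega>, Y \<omega>))"
proof (rule pair_measure_eqI)
  show "sigma_finite_measure (distr M S X)" "sigma_finite_measure (distr M T Y)"
    using X Y by (auto intro!: prob_space_imp_sigma_finite prob_space_distr)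
  show "sets (distr M S X \<Otimes>\<^sub>M distr M T Y) = sets (distr M (S \<Otimes>\<^sub>M T) (\<lambda>\<omega>. (X \<omega>, Y \<omega>)))"
    by (simp cong: sets_pair_measure_cong)
  fix A B assume "A \<in> sets (distr M S X)" "B \<in> sets (distr M T Y)"
  then have A: "A \<in> sets S" and B: "B \<in> sets T"
    by auto
  have "prob ((X -` A \<inter> space M) \<inter> (Y -` B \<inter> space M)) = prob (X -` A \<inter> space M) * prob (Y -` B \<inter> space M)"
    using A B by (intro indep_setD[OF ind]) auto
  moreover have "(\<lambda>\<omega>. (X \<omega>, Y \<omega>)) -` (A \<times> B) \<inter> space M = (X -` A \<inter> space M) \<inter> (Y -` B \<inter> space M)"
    by auto
  ultimately show "emeasure (distr M S X) A * emeasure (distr M T Y) B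
      = emeasure (distr M (S \<Otimes>\<^sub>M T) (\<lambda>\<omega>. (X \<omega>, Y \<omega>))) (A \<times> B)"
    using A B X Y by (simp add: emeasure_distr emeasure_eq_measure ennreal_mult)
qed

text \<open>Independence makes the joint law a product of two affine images of standard normal laws,
  and the two sources merge into one Gaussian on the product space. The factors \<open>A\<close> and
  \<open>B\<close> are kept so that the covariance can be recovered.\<close>

lemma normal_law_stack:
  fixes X :: "'a \<Rightarrow> real^'n" and Y :: "'a \<Rightarrow> real^'m"
  assumes P: "prob_space P"
    and X: "has_normal_law P X \<mu>X \<Sigma>X" and Y: "has_normal_law P Y \<mu>Y \<Sigma>Y"
    and ind: "prob_space.indep_set P {X -` A \<inter> space P | A. A \<in> sets borel}
                {Y -` B \<inter> space P | B. B \<in> sets borel}"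
  obtains A :: "real^'n^'n" and B :: "real^'m^'m" and c :: real
  where "A ** transpose A = \<Sigma>X" "B ** transpose B = \<Sigma>Y" "0 \<le> c"
    "distr P borel (\<lambda>\<omega>. stack (X \<omega>) (Y \<omega>))
       = distr (gauss_measure c) borel (\<lambda>g. stack \<mu>X \<mu>Y + stack (A *v fst g) (B *v snd g))"
proof -
  interpret prob_space P
    by fact
  obtain A :: "real^'n^'n" where A: "A ** transpose A = \<Sigma>X"
    and lawX: "distr P borel X = distr std_normal_vec borel (\<lambda>g. \<mu>X + A *v g)"
    using X unfolding has_normal_law_def by blast
  obtain B :: "real^'m^'m" where B: "B ** transpose B = \<Sigma>Y"
    and lawY: "distr P borel Y = distr std_normal_vec borel (\<lambda>g. \<mu>Y + B *v g)"
    using Y unfolding has_normal_law_def by blast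
  have [measurable]: "X \<in> borel_measurable P" "Y \<in> borel_measurable P"
    using X Y by (auto simp: has_normal_law_def)
  define c where "c = (1 / sqrt (2 * pi)) ^ CARD('n)"
  define d where "d = (1 / sqrt (2 * pi)) ^ CARD('m)"
  have st [measurable]: "(\<lambda>p. stack (fst p) (snd p)) \<in> borel_measurable (borel \<Otimes>\<^sub>M borel)"
    using linear_borel_measurable[OF linear_stack] by (simp add: borel_prod)
  have [measurable]: "(\<lambda>g. \<mu>X + A *v g) \<in> borel_measurable borel"
    "(\<lambda>g. \<mu>Y + B *v g) \<in> borel_measurable borel"
    by (intro borel_measurable_continuous_onI continuous_intros)+
  have sfY: "sigma_finite_measure (distr P borel Y)"
    by (intro prob_space_imp_sigma_finite prob_space_distr) measurable
  \<comment> \<open>Finiteness is read off from \<open>Y\<close> instead of a Gaussian integral: the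
    image of this measure is the law of \<open>Y\<close>, of total mass 1.\<close>
  have sf: "sigma_finite_measure (gauss_measure d :: (real^'m) measure)"
  proof (rule finite_measure.axioms(1))
    show "finite_measure (gauss_measure d :: (real^'m) measure)"
    proof (rule finite_measureI)
      have "emeasure (gauss_measure d :: (real^'m) measure) (space (gauss_measure d :: (real^'m) measure))
          = emeasure (distr std_normal_vec borel (\<lambda>g. \<mu>Y + B *v g)) UNIV"
        by (subst emeasure_distr)
          (auto simp: std_normal_vec_eq_gauss_measure d_def gauss_measure_def)
      also have "\<dots> = emeasure P (space P)"
        unfolding lawY[symmetric] by (subst emeasure_distr) auto
      finally show "emeasure (gauss_measure d :: (real^'m) measure)
          (space (gauss_measure d :: (real^'m) measure)) \<noteq> \<infinity>"
        by (simp add: emeasure_space_1)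
    qed
  qed
  have "distr P (borel \<Otimes>\<^sub>M borel) (\<lambda>\<omega>. (X \<omega>, Y \<omega>)) = distr P borel X \<Otimes>\<^sub>M distr P borel Y"
    by (rule distr_Pair_indep_set[OF _ _ ind, symmetric]) measurable
  also have "\<dots> = distr (gauss_measure c \<Otimes>\<^sub>M gauss_measure d) (borel \<Otimes>\<^sub>M borel)
      (\<lambda>(g, h). (\<mu>X + A *v g, \<mu>Y + B *v h))"
    using sfY unfolding lawX lawY std_normal_vec_eq_gauss_measure c_def[symmetric] d_def[symmetric]
    by (intro pair_measure_distr) (simp_all add: measurable_cong_sets[OF sets_gauss_measure refl])
  also have "gauss_measure c \<Otimes>\<^sub>M gauss_measure d = (gauss_measure (c * d) :: ((real^'n) \<times> (real^'m)) measure)"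
    using sf by (intro pair_gauss_measure) (simp_all add: c_def)
  finally have joint: "distr P (borel \<Otimes>\<^sub>M borel) (\<lambda>\<omega>. (X \<omega>, Y \<omega>))
      = distr (gauss_measure (c * d)) (borel \<Otimes>\<^sub>M borel) (\<lambda>(g, h). (\<mu>X + A *v g, \<mu>Y + B *v h))" .
  have aff: "(\<lambda>(g, h). (\<mu>X + A *v g, \<mu>Y + B *v h)) \<in> gauss_measure (c * d) \<rightarrow>\<^sub>M borel \<Otimes>\<^sub>M borel"
  proof -
    have "(\<lambda>(g, h). (\<mu>X + A *v g, \<mu>Y + B *v h)) \<in> borel \<Otimes>\<^sub>M borel \<rightarrow>\<^sub>M borel \<Otimes>\<^sub>M borel"
      by measurable
    then show ?thesis
      by (simp add: measurable_cong_sets[OF sets_gauss_measure refl] borel_prod)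
  qed
  have "distr P borel (\<lambda>\<omega>. stack (X \<omega>) (Y \<omega>))
      = distr (distr P (borel \<Otimes>\<^sub>M borel) (\<lambda>\<omega>. (X \<omega>, Y \<omega>))) borel (\<lambda>p. stack (fst p) (snd p))"
    by (subst distr_distr) (simp_all add: comp_def)
  also have "\<dots> = distr (gauss_measure (c * d)) borel
      (\<lambda>g. stack (\<mu>X + A *v fst g) (\<mu>Y + B *v snd g))"
    unfolding joint using aff by (subst distr_distr) (simp_all add: comp_def case_prod_beta')
  also have "(\<lambda>g. stack (\<mu>X + A *v fst g) (\<mu>Y + B *v snd g))
      = (\<lambda>g. stack \<mu>X \<mu>Y + stack (A *v fst g) (B *v snd g))"
  proof
    show "stack (\<mu>X + A *v fst g) (\<mu>Y + B *v snd g) = stack \<mu>X \<mu>Y + stack (A *v fst g) (B *v snd g)" for g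
      using linear_add[OF linear_stack, of "(\<mu>X, \<mu>Y)" "(A *v fst g, B *v snd g)"] by simp
  qed
  finally show thesis
    by (intro that[OF A B]) (simp_all add: c_def d_def)
qed

section \<open>Conditioning event and nuisance vector in stacked form\<close>

lemma sets_sign_basis_event:
  fixes basis :: "real^'n \<Rightarrow> real^'m \<Rightarrow> ('n \<times> 'm) set"
  assumes basis: "(\<lambda>(x, y). basis x y) \<in> borel \<rightarrow>\<^sub>M count_space UNIV"
  shows "{v. sign_vec (block1 v) (block2 v) = s \<and> basis (block1 v) (block2 v) = J} \<in> sets borel"
proof -
  have "linear (\<lambda>v. (block1 v, block2 v) :: (real^'n) \<times> (real^'m))"
    by (auto intro!: linearI simp: linear_add[OF linear_block(1)] linear_add[OF linear_block(2)]
        linear_scale[OF linear_block(1)] linear_scale[OF linear_block(2)])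
  from measurable_compose[OF linear_borel_measurable[OF this] basis]
  have [measurable]: "(\<lambda>v. basis (block1 v) (block2 v)) \<in> borel \<rightarrow>\<^sub>M count_space UNIV"
    by simp
  have [measurable]: "(\<lambda>v. (Omega *v v) $ p) \<in> borel_measurable borel" for p :: "'n \<times> 'm"
    by (intro borel_measurable_continuous_onI continuous_intros)
  \<comment> \<open>Entrywise, the sign condition becomes a finite conjunction of measurable
    predicates.\<close>
  have "{v. sign_vec (block1 v) (block2 v) = s \<and> basis (block1 v) (block2 v) = J}
      = {v. (\<forall>p. sgn ((Omega *v v) $ p) = s $ p) \<and> basis (block1 v) (block2 v) = J}"
    by (simp add: sign_vec_def vec_eq_iff)
  also have "\<dots> \<in> sets borel"
    by measurable
  finally show ?thesis .
qed

text \<open>The subtracted matrix has rank one. In this form the truncation region is the set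
  truncated to in \<open>gauss_truncated_coverage\<close>.\<close>

lemma nuisance_eq: "nuisance \<Sigma> \<eta> v = v - (\<eta> \<bullet> v) *\<^sub>R dir_b \<Sigma> \<eta>"
  by (simp add: nuisance_def matrix_vector_mult_diff_rdistrib)
    (simp add: vec_eq_iff matrix_vector_mult_def inner_vec_def sum_distrib_right mult_ac sum_distrib_left)

section \<open>Coverage of the selective interval\<close>

theorem mainTheorem1:
  fixes P :: "'a measure"
    and X :: "'a \<Rightarrow> real^'n"
    and Y :: "'a \<Rightarrow> real^'m::{finite,linorder}"
    and \<mu>X :: "real^'n" and \<Sigma>X :: "real^'n^'n"
    and \<mu>Y :: "real^'m::{finite,linorder}" and \<Sigma>Y :: "real^'m::{finite,linorder}^'m::{finite,linorder}"
    and basis :: "real^'n \<Rightarrow> real^'m::{finite,linorder} \<Rightarrow> ('n \<times> 'm) set"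
    and xobs :: "real^'n" and yobs :: "real^'m::{finite,linorder}"
    and \<Sigma> :: "real^('n + 'm)^('n + 'm)"
    and sobs :: "real^('n \<times> 'm)" and Mobs :: "('n \<times> 'm) set"
    and \<eta> :: "real^('n + 'm)"
    and \<alpha> Wstar :: real
  assumes "prob_space P"
    and "has_normal_law P X \<mu>X \<Sigma>X"
    and "has_normal_law P Y \<mu>Y \<Sigma>Y"
    and "prob_space.indep_set P {X -` A \<inter> space P | A. A \<in> sets borel}
                             {Y -` B \<inter> space P | B. B \<in> sets borel}"
    and "lp_nondegenerate TYPE('n) TYPE('m)"
    and "\<And>x y. optimal_basis x y (basis x y)"
    and "(\<lambda>(x, y). basis x y) \<in> borel \<rightarrow>\<^sub>M count_space UNIV"
    and "\<Sigma> = block_diag \<Sigma>X \<Sigma>Y"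
    and "sobs = sign_vec xobs yobs"
    and "Mobs = basis xobs yobs"
    and "\<P>(\<omega> in P. sign_vec (X \<omega>) (Y \<omega>) = sobs \<and> basis (X \<omega>) (Y \<omega>) = Mobs) > 0"
    and "\<eta> = test_direction sobs Mobs"
    and "\<eta> \<bullet> (\<Sigma> *v \<eta>) > 0"
    and "Wstar = \<eta> \<bullet> stack \<mu>X \<mu>Y"
    and "0 \<le> \<alpha>" and "\<alpha> \<le> 1"
  shows "\<P>(\<omega> in P. Wstar \<in> selective_ci \<alpha> basis \<Sigma> sobs Mobs (X \<omega>) (Y \<omega>)
           \<bar> sign_vec (X \<omega>) (Y \<omega>) = sign_vec xobs yobs \<and> basis (X \<omega>) (Y \<omega>) = Mobs) = 1 - \<alpha>"
proof -
  interpret prob_space P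
    by fact
  obtain A :: "real^'n^'n" and B :: "real^'m::{finite,linorder}^'m::{finite,linorder}" and c where AB: "A ** transpose A = \<Sigma>X" "B ** transpose B = \<Sigma>Y" and c: "0 \<le> c"
    and law: "distr P borel (\<lambda>\<omega>. stack (X \<omega>) (Y \<omega>))
       = distr (gauss_measure c) borel (\<lambda>g. stack \<mu>X \<mu>Y + stack (A *v fst g) (B *v snd g))"
    by (rule normal_law_stack[OF assms(1-4)])
  define L where "L = (\<lambda>g. stack (A *v fst g) (B *v snd g))"
  \<comment> \<open>The adjoint of \<open>L\<close> applied to \<open>\<eta>\<close>.\<close>
  define a where "a = (transpose A *v block1 \<eta>, transpose B *v block2 \<eta>)"
  have "linear (\<lambda>g. (A *v fst g, B *v snd g))"
    by (rule linearI) (auto simp: matrix_vector_right_distrib matrix_vector_mult_scaleR)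
  from linear_compose[OF this linear_stack] have L: "linear L"
    by (simp add: L_def comp_def)
  have a: "\<eta> \<bullet> L g = a \<bullet> g" for g
    by (simp add: L_def a_def inner_stack inner_prod_def dot_lmul_matrix[symmetric]
        vector_transpose_matrix)
  \<comment> \<open>\<open>L\<close> times its adjoint is \<open>\<Sigma>\<close>. Hence the squared
    norm of \<open>a\<close> is the variance of the statistic, and the direction \<open>b\<close> of
    the coverage lemma is \<open>dir_b \<Sigma> \<eta>\<close>.\<close>
  have La: "L a = \<Sigma> *v \<eta>"
    by (simp add: L_def a_def assms(8) block_diag_mult AB[symmetric] matrix_vector_mul_assoc
        del: vector_transpose_matrix transpose_matrix_vector)
  have var: "\<eta> \<bullet> (\<Sigma> *v \<eta>) = (norm a)\<^sup>2"
    using a[of a] by (simp add: La dot_square_norm)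
  have a0: "a \<noteq> 0"
    using assms(13) var by auto
  have b: "(1 / (norm a)\<^sup>2) *\<^sub>R L a = dir_b \<Sigma> \<eta>"
    by (simp add: dir_b_def La var)
  define E where "E = {v. sign_vec (block1 v) (block2 v) = sobs \<and> basis (block1 v) (block2 v) = Mobs}"
  have E: "E \<in> sets borel"
    unfolding E_def by (rule sets_sign_basis_event) fact
  define F where "F = (\<lambda>v. cdf (uniform_measure (density lborel (normal_density Wstar (norm a)))
                       {z. v - (\<eta> \<bullet> v) *\<^sub>R dir_b \<Sigma> \<eta> + z *\<^sub>R dir_b \<Sigma> \<eta> \<in> E}) (\<eta> \<bullet> v))"
  define C where "C = {v. \<alpha> / 2 \<le> F v \<and> F v \<le> 1 - \<alpha> / 2}"
  let ?Q = "distr P borel (\<lambda>\<omega>. stack (X \<omega>) (Y \<omega>))"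
  have C: "C \<in> sets borel" and coverage: "emeasure ?Q (E \<inter> C) = ennreal (1 - \<alpha>) * emeasure ?Q E"
    using gauss_truncated_coverage[OF L a a0 c E assms(15,16), of "stack \<mu>X \<mu>Y",
      unfolded b assms(14)[symmetric]]
    unfolding C_def F_def law L_def by (simp_all only:)
  \<comment> \<open>Membership evaluates the c.d.f. at \<open>w = Wstar\<close>, the true mean of
    the statistic, so \<open>F\<close> truncates the correct normal law.\<close>
  have ci: "Wstar \<in> selective_ci \<alpha> basis \<Sigma> sobs Mobs (X \<omega>) (Y \<omega>) \<longleftrightarrow> stack (X \<omega>) (Y \<omega>) \<in> C" for \<omega>
    unfolding selective_ci_def Let_def assms(12)[symmetric] trunc_normal_cdf_def trunc_region_def
      nuisance_eq var by (simp add: C_def F_def E_def)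
  have ev: "sign_vec (X \<omega>) (Y \<omega>) = sobs \<and> basis (X \<omega>) (Y \<omega>) = Mobs \<longleftrightarrow> stack (X \<omega>) (Y \<omega>) \<in> E" for \<omega>
    by (simp add: E_def)
  have XY: "(\<lambda>\<omega>. stack (X \<omega>) (Y \<omega>)) \<in> borel_measurable P"
  proof -
    have "X \<in> borel_measurable P" "Y \<in> borel_measurable P"
      using assms(2,3) by (auto simp: has_normal_law_def)
    then have "(\<lambda>\<omega>. (X \<omega>, Y \<omega>)) \<in> P \<rightarrow>\<^sub>M borel"
      by (simp add: borel_prod[symmetric])
    from measurable_compose[OF this linear_borel_measurable[OF linear_stack]] show ?thesis
      by simp
  qed
  have prob: "ennreal \<P>(\<omega> in P. stack (X \<omega>) (Y \<omega>) \<in> D) = emeasure ?Q D"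
    if "D \<in> sets borel" for D
    using that XY by (simp add: emeasure_distr emeasure_eq_measure vimage_def Int_def conj_commute)
  have "ennreal \<P>(\<omega> in P. stack (X \<omega>) (Y \<omega>) \<in> E \<inter> C) = ennreal ((1 - \<alpha>) * \<P>(\<omega> in P. stack (X \<omega>) (Y \<omega>) \<in> E))"
    using coverage assms(16) by (simp only: prob[OF E] prob[OF sets.Int[OF E C]] ennreal_mult measure_nonneg diff_ge_0_iff_ge)
  then have "\<P>(\<omega> in P. stack (X \<omega>) (Y \<omega>) \<in> E \<inter> C) = (1 - \<alpha>) * \<P>(\<omega> in P. stack (X \<omega>) (Y \<omega>) \<in> E)"
    using assms(16) by (subst (asm) ennreal_inj) auto
  \<comment> \<open>The conditioning event has positive probability, so it can be divided
    out.\<close>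
  then show ?thesis
    using assms(11) unfolding cond_prob_def assms(9)[symmetric] ci ev
    by (simp add: conj_commute)
qed

end
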